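(* Any maximal $MCC_i$-chain $L$ of an $H$-closed upper regularly ordered topological pospace contains a minimal element of $L$.
   Context: All topological spaces are Hausdorff. A topological pospace is a topological space $X$ equipped with a continuous (closed) partial order $\leqslant$, i.e. one whose graph is closed in $X\times X$. A topological pospace $X$ is $H$-closed if $X$ is a closed subspace of every Hausdorff topological pospace in which it is contained (as a subspace with the induced order). A chain is a subset linearly ordered by the partial order; a maximal chain is a chain properly contained in no other chain. For $A\subseteq X$, ${\uparrow}A=\{y\in X\mid x\leqslant y\text{ for some }x\in A\}$ and ${\downarrow}A=\{y\in X\mid y\leqslant x\text{ for some }x\in A\}$; $A$ is increasing if $A={\uparrow}A$ and decreasing if $A={\downarrow}A$. An $MCC_i$-chain in $X$ is a maximal chain $L$ of $X$ such that ${\uparrow}L$ is closed in $X$ (so "maximal $MCC_i$-chain" means the same as $MCC_i$-chain). A topological pospace $X$ is upper regularly ordered if for each closed increasing subset $F$ of $X$ and each $a\notin F$ there exist disjoint open neighbourhoods $U$ of $a$ and $V$ of $F$ such that $U$ is decreasing and $V$ is increasing in $X$. An element $y$ of a partially ordered set $A$ is minimal in $A$ if $x\leqslant y$ with $x\in A$ implies $y\leqslant x$. *)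

theory Defs
  imports "HOL-Analysis.Analysis"
begin

(* A pospace is a topology X together with its order given as a relation on topspace X. *)

definition pospace :: "'a topology \<Rightarrow> 'a rel \<Rightarrow> bool" where
  "pospace X r \<longleftrightarrow>
     Hausdorff_space X \<and>
     partial_order_on (topspace X) r \<and> closedin (prod_topology X X) r"

definition pospace_embedding ::
  "'a topology \<Rightarrow> 'a rel \<Rightarrow> 'b topology \<Rightarrow> 'b rel \<Rightarrow> ('a \<Rightarrow> 'b) \<Rightarrow> bool" where
  "pospace_embedding X r Y s f \<longleftrightarrow>
     embedding_map X Y f \<and>
     (\<forall>x\<in>topspace X. \<forall>y\<in>topspace X. (f x, f y) \<in> s \<longleftrightarrow> (x, y) \<in> r)"

(* "X is a subspace of Y" is rendered by an embedding of X into Y, since the points of a pospace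
   containing X need not be available in the type 'a. A definition cannot quantify over types;
   pospaces over 'a option suffice, and H_closed_pospaceD recovers the property for pospaces
   over an arbitrary type. *)

definition H_closed_pospace :: "'a topology \<Rightarrow> 'a rel \<Rightarrow> bool" where
  "H_closed_pospace X r \<longleftrightarrow>
     pospace X r \<and>
     (\<forall>(Y :: 'a option topology) s f.
        pospace Y s \<longrightarrow> pospace_embedding X r Y s f \<longrightarrow> closedin Y (f ` topspace X))"

lemma H_closed_pospaceD:
  fixes X :: "'a topology" and Y :: "'b topology"
  assumes "H_closed_pospace X r" and Y: "pospace Y s" and f: "pospace_embedding X r Y s f"
  shows "closedin Y (f ` topspace X)"
proof -
  have fY: "f ` topspace X \<subseteq> topspace Y"
    using f unfolding pospace_embedding_def embedding_map_def homeomorphic_map_def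
    by (metis continuous_map_image_subset_topspace continuous_map_in_subtopology quotient_imp_continuous_map)
  have inj: "inj_on f (topspace X)"
    using f unfolding pospace_embedding_def embedding_map_def homeomorphic_map_def by blast
  have "\<exists>U. openin Y U \<and> y \<in> U \<and> U \<subseteq> topspace Y - f ` topspace X"
    if y: "y \<in> topspace Y - f ` topspace X" for y
  proof -
    define h where "h = case_option y f"
    define A where "A = insert None (Some ` topspace X)"
    define Z where "Z = pullback_topology A h Y"
    define t where "t = {(u, v). u \<in> A \<and> v \<in> A \<and> (h u, h v) \<in> s}"
    have topZ: "topspace Z = A"
      using y fY by (auto simp: Z_def topspace_pullback_topology A_def h_def)
    have hinj: "inj_on h A"
      using y inj by (auto simp: A_def h_def inj_on_def)
    have hcont: "continuous_map Z Y h"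
      unfolding Z_def using continuous_map_pullback[of Y Y id A h] by simp
    have "Hausdorff_space Z"
      using Hausdorff_space_injective_preimage[of Y Z h] Y hcont hinj topZ by (simp add: pospace_def)
    moreover have "partial_order_on (topspace Z) t"
    proof -
      have po: "refl_on (topspace Y) s" "trans s" "antisym s"
        using Y partial_order_onD unfolding pospace_def by blast+
      have hA: "h ` A \<subseteq> topspace Y"
        using hcont topZ continuous_map_image_subset_topspace by blast
      have "refl_on A t"
        using po(1) hA by (auto simp: t_def refl_on_def)
      moreover have "trans t"
        using po(2) unfolding t_def trans_def by blast
      moreover have "antisym t"
        using po(3) hinj unfolding t_def antisym_def inj_on_def by blast
      ultimately show ?thesis
        unfolding topZ partial_order_on_def preorder_on_def by (auto simp: t_def)
    qed
    moreover have "closedin (prod_topology Z Z) t"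
    proof -
      have "continuous_map (prod_topology Z Z) (prod_topology Y Y) (\<lambda>(u, v). (h u, h v))"
        using continuous_map_prod_top[of Z Z Y Y h h] hcont by simp
      then have "closedin (prod_topology Z Z)
          {p \<in> topspace (prod_topology Z Z). (\<lambda>(u, v). (h u, h v)) p \<in> s}"
        using Y unfolding pospace_def by (intro closedin_continuous_map_preimage) auto
      moreover have "{p \<in> topspace (prod_topology Z Z). (\<lambda>(u, v). (h u, h v)) p \<in> s} = t"
        by (auto simp: t_def topZ)
      ultimately show ?thesis by simp
    qed
    ultimately have Z: "pospace Z t"
      by (simp add: pospace_def)
    have "embedding_map X Z Some"
    proof -
      obtain g where g: "homeomorphic_maps X (subtopology Y (f ` topspace X)) f g"
        using f unfolding pospace_embedding_def embedding_map_def homeomorphic_map_maps by blast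
      have "continuous_map X Y f"
        using g continuous_map_in_subtopology unfolding homeomorphic_maps_def by blast
      then have "continuous_map X Y (h \<circ> Some)"
        by (simp add: h_def comp_def)
      then have "continuous_map X Z Some"
        unfolding Z_def by (rule continuous_map_pullback') (auto simp: A_def)
      moreover have "continuous_map (subtopology Z (Some ` topspace X)) X (g \<circ> h)"
      proof (rule continuous_map_compose)
        show "continuous_map (subtopology Z (Some ` topspace X)) (subtopology Y (f ` topspace X)) h"
          using hcont by (auto simp: continuous_map_in_subtopology continuous_map_from_subtopology h_def)
        show "continuous_map (subtopology Y (f ` topspace X)) X g"
          using g unfolding homeomorphic_maps_def by blast
      qed
      ultimately have "homeomorphic_maps X (subtopology Z (Some ` topspace X)) Some (g \<circ> h)"
        using g by (auto simp: homeomorphic_maps_def continuous_map_in_subtopology h_def)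
      then show ?thesis
        unfolding embedding_map_def homeomorphic_map_maps by blast
    qed
    then have "pospace_embedding X r Z t Some"
      using f by (auto simp: pospace_embedding_def t_def A_def h_def)
    then have "closedin Z (Some ` topspace X)"
      using assms(1) Z unfolding H_closed_pospace_def by blast
    then have "openin Z (topspace Z - Some ` topspace X)"
      by blast
    moreover have "topspace Z - Some ` topspace X = {None}"
      by (auto simp: topZ A_def)
    ultimately obtain U where U: "openin Y U" "{None} = h -` U \<inter> A"
      unfolding Z_def openin_pullback_topology by auto
    have "None \<in> h -` U"
      using U(2) by blast
    then have "y \<in> U"
      by (simp add: h_def)
    moreover have "f x \<notin> U" if "x \<in> topspace X" for x
    proof
      assume "f x \<in> U"
      then have "Some x \<in> h -` U \<inter> A"
        using that by (simp add: h_def A_def)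
      then show False
        using U(2) by blast
    qed
    ultimately show ?thesis
      using U(1) openin_subset by blast
  qed
  then have "openin Y (topspace Y - f ` topspace X)"
    by (subst openin_subopen) blast
  then show ?thesis
    using fY by (simp add: closedin_def)
qed

definition maximal_chain :: "'a rel \<Rightarrow> 'a set \<Rightarrow> bool" where
  "maximal_chain r L \<longleftrightarrow> L \<in> Chains r \<and> (\<forall>M\<in>Chains r. \<not> L \<subset> M)"

(* The up-set of A is r `` A and the down-set of A is r\<inverse> `` A. *)

definition increasing_set :: "'a rel \<Rightarrow> 'a set \<Rightarrow> bool" where
  "increasing_set r A \<longleftrightarrow> A = r `` A"

definition decreasing_set :: "'a rel \<Rightarrow> 'a set \<Rightarrow> bool" where
  "decreasing_set r A \<longleftrightarrow> A = r\<inverse> `` A"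

definition MCC_i_chain :: "'a topology \<Rightarrow> 'a rel \<Rightarrow> 'a set \<Rightarrow> bool" where
  "MCC_i_chain X r L \<longleftrightarrow> maximal_chain r L \<and> closedin X (r `` L)"

definition upper_regularly_ordered :: "'a topology \<Rightarrow> 'a rel \<Rightarrow> bool" where
  "upper_regularly_ordered X r \<longleftrightarrow>
     (\<forall>F a. closedin X F \<longrightarrow> increasing_set r F \<longrightarrow> a \<in> topspace X - F \<longrightarrow>
        (\<exists>U V. openin X U \<and> openin X V \<and> a \<in> U \<and> F \<subseteq> V \<and> disjnt U V \<and>
               decreasing_set r U \<and> increasing_set r V))"

definition minimal_in :: "'a rel \<Rightarrow> 'a set \<Rightarrow> 'a \<Rightarrow> bool" where
  "minimal_in r A y \<longleftrightarrow> y \<in> A \<and> (\<forall>x\<in>A. (x, y) \<in> r \<longrightarrow> (y, x) \<in> r)"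

end

theory Submission
  imports Defs
begin

text \<open>
  In a chain minimal means least. Suppose that \<open>L\<close> has no least element, and adjoin to \<open>X\<close> a new
  point \<open>\<infinity>\<close> (the value \<open>None\<close> of the option type) as the missing lower end of \<open>L\<close>: its neighbourhoods trace open sets of
  \<open>X\<close> that contain a lower tail of \<open>L\<close>, the points above it are those of the up-set of \<open>L\<close>, and no
  point of \<open>X\<close> lies below it. Since every neighbourhood of \<open>\<infinity>\<close> meets \<open>L\<close>, the subspace \<open>X\<close> is not
  closed in the extension, which contradicts H-closedness once the extension is known to be a
  pospace. Lemma \<open>H_closed_pospace_no_new_lower_limit\<close> carries out this construction for an arbitrary
  filter in place of the lower tails of \<open>L\<close>.

  The point is that its order is closed, and upper regularity gives this twice. A point \<open>x\<close> of \<open>X\<close>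
  is not a lower bound of \<open>L\<close>, for by maximality it would belong to \<open>L\<close> and be least in it. So some
  \<open>l \<in> L\<close> lies outside the up-set of \<open>x\<close>, which is closed and increasing. Separating the two gives
  a decreasing neighbourhood of \<open>l\<close>, hence a neighbourhood of \<open>\<infinity>\<close>, and an increasing neighbourhood
  of \<open>x\<close>, with no point of the latter below a point of the former. This makes the non-relation
  \<open>x \<le> \<infinity>\<close> stable, and also separates \<open>x\<close> from \<open>\<infinity>\<close>. If \<open>\<infinity> \<le> x\<close> fails, then \<open>x\<close> lies outside the
  up-set of \<open>L\<close>. This up-set is closed because \<open>L\<close> is an MCC-chain, and separating \<open>x\<close> from it gives
  the remaining neighbourhoods.
\<close>

section \<open>Adjoining a limit point of a filter\<close>

text \<open>
  This is the finest topology for which \<open>X\<close> is an open subspace and the filter converges to the new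
  point. Openness of the trace on \<open>X\<close> is required also of the neighbourhoods of \<open>None\<close>, so that every
  filter may be used, such as the one of the lower tails of a chain, which are hardly ever open.
\<close>

definition adjoin_limit_topology :: "'a topology \<Rightarrow> 'a filter \<Rightarrow> 'a option topology" where
  "adjoin_limit_topology X G =
     topology (\<lambda>S. openin X (Some -` S) \<and> (None \<in> S \<longrightarrow> (\<forall>\<^sub>F x in G. Some x \<in> S)))"

lemma openin_adjoin_limit_topology:
  "openin (adjoin_limit_topology X G) S \<longleftrightarrow>
     openin X (Some -` S) \<and> (None \<in> S \<longrightarrow> (\<forall>\<^sub>F x in G. Some x \<in> S))"
proof -
  have "istopology (\<lambda>S. openin X (Some -` S) \<and> (None \<in> S \<longrightarrow> (\<forall>\<^sub>F x in G. Some x \<in> S)))"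
    unfolding istopology_def
  proof (intro conjI allI impI, goal_cases)
    case (1 S T)
    then show ?case by (simp add: vimage_Int openin_Int)
  next
    case (2 S T)
    then show ?case by (simp add: eventually_conj_iff)
  next
    case (3 K)
    then show ?case by (auto simp: vimage_Union)
  next
    case (4 K)
    then obtain S where "S \<in> K" "\<forall>\<^sub>F x in G. Some x \<in> S" by blast
    then show ?case by (auto elim: eventually_mono)
  qed
  then show ?thesis
    by (simp add: adjoin_limit_topology_def topology_inverse')
qed

lemma topspace_adjoin_limit_topology:
  assumes "\<forall>\<^sub>F x in G. x \<in> topspace X"
  shows "topspace (adjoin_limit_topology X G) = insert None (Some ` topspace X)"
proof -
  have "Some -` insert None (Some ` topspace X) = topspace X" by auto
  then have "openin (adjoin_limit_topology X G) (insert None (Some ` topspace X))"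
    using assms by (simp add: openin_adjoin_limit_topology image_iff)
  moreover have "S \<subseteq> insert None (Some ` topspace X)"
    if "openin (adjoin_limit_topology X G) S" for S
  proof
    fix z assume "z \<in> S"
    moreover have "Some -` S \<subseteq> topspace X"
      using that openin_subset by (auto simp: openin_adjoin_limit_topology)
    ultimately show "z \<in> insert None (Some ` topspace X)"
      by (cases z) auto
  qed
  ultimately show ?thesis
    by (meson openin_subset openin_topspace subset_antisym)
qed

lemma openin_adjoin_limit_topology_Some:
  "openin (adjoin_limit_topology X G) (Some ` U) \<longleftrightarrow> openin X U"
  by (simp add: openin_adjoin_limit_topology inj_vimage_image_eq image_iff)

lemma openin_adjoin_limit_topology_None:
  "openin (adjoin_limit_topology X G) (insert None (Some ` N)) \<longleftrightarrow>
     openin X N \<and> (\<forall>\<^sub>F x in G. x \<in> N)"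
proof -
  have "Some -` insert None (Some ` N) = N" by auto
  then show ?thesis by (simp add: openin_adjoin_limit_topology image_iff)
qed

lemma embedding_map_adjoin_limit_topology: "embedding_map X (adjoin_limit_topology X G) Some"
proof (rule injective_open_imp_embedding_map)
  show "continuous_map X (adjoin_limit_topology X G) Some"
    unfolding continuous_map
  proof (intro conjI allI impI)
    have "openin (adjoin_limit_topology X G) (Some ` topspace X)"
      by (simp add: openin_adjoin_limit_topology_Some)
    then show "Some ` topspace X \<subseteq> topspace (adjoin_limit_topology X G)"
      by (rule openin_subset)
    fix S assume "openin (adjoin_limit_topology X G) S"
    then have "openin X (Some -` S)" by (simp add: openin_adjoin_limit_topology)
    moreover from this have "{x \<in> topspace X. Some x \<in> S} = Some -` S"
      using openin_subset by fastforce
    ultimately show "openin X {x \<in> topspace X. Some x \<in> S}" by simp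
  qed
  show "open_map X (adjoin_limit_topology X G) Some"
    by (simp add: open_map_def openin_adjoin_limit_topology_Some)
qed simp

section \<open>The extension as a pospace\<close>

text \<open>
  For a proper filter the added point is in the closure of \<open>X\<close>, so the two separation hypotheses,
  which say that placing this point just below \<open>F\<close> keeps the order closed, cannot hold in an
  H-closed pospace.
\<close>

lemma H_closed_pospace_no_new_lower_limit:
  fixes X :: "'a topology" and G :: "'a filter"
  assumes H: "H_closed_pospace X r"
    and GX: "\<forall>\<^sub>F x in G. x \<in> topspace X"
    and F: "F \<subseteq> topspace X" "r `` F \<subseteq> F"
    and not_below: "\<And>x. x \<in> topspace X \<Longrightarrow> \<exists>U N. openin X U \<and> openin X N \<and> x \<in> U \<and>
            (\<forall>\<^sub>F w in G. w \<in> N) \<and> r \<inter> U \<times> N = {}"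
    and not_above: "\<And>x. x \<in> topspace X - F \<Longrightarrow> \<exists>U N. openin X U \<and> openin X N \<and> x \<in> U \<and>
            (\<forall>\<^sub>F w in G. w \<in> N) \<and> disjnt U F \<and> r \<inter> N \<times> U = {}"
  shows "G = bot"
proof (rule ccontr)
  assume nonbot: "G \<noteq> bot"
  define Y where "Y = adjoin_limit_topology X G"
  define s where "s = map_prod Some Some ` r \<union> {None} \<times> insert None (Some ` F)"
  have s_simps [simp]: "(Some x, Some y) \<in> s \<longleftrightarrow> (x, y) \<in> r" "(Some x, None) \<notin> s"
      "(None, None) \<in> s" "(None, Some y) \<in> s \<longleftrightarrow> y \<in> F" for x y
    by (auto simp: s_def)
  have X: "Hausdorff_space X" "closedin (prod_topology X X) r"
    and r: "r \<subseteq> topspace X \<times> topspace X" "refl_on (topspace X) r" "trans r" "antisym r"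
    using H by (auto simp: H_closed_pospace_def pospace_def partial_order_on_def preorder_on_def)
  note topY = topspace_adjoin_limit_topology[OF GX, folded Y_def]
  note openY_Some = openin_adjoin_limit_topology_Some[of X G, folded Y_def]
  note openY_None = openin_adjoin_limit_topology_None[of X G, folded Y_def]

  have sep: "\<exists>A B. openin Y A \<and> openin Y B \<and> Some x \<in> A \<and> None \<in> B \<and> disjnt A B"
    if x: "x \<in> topspace X" for x
  proof -
    obtain U N where UN: "openin X U" "openin X N" "x \<in> U" "\<forall>\<^sub>F w in G. w \<in> N" "r \<inter> U \<times> N = {}"
      using not_below[OF x] by blast
    \<comment> \<open>By reflexivity, a common point would be related to itself.\<close>
    have "U \<inter> N = {}"
      using UN(5) openin_subset[OF UN(1)] r(2) by (fastforce simp: refl_on_def)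
    then have "disjnt (Some ` U) (insert None (Some ` N))"
      by (auto simp: disjnt_def)
    then show ?thesis
      using UN openY_Some openY_None by blast
  qed
  have "Hausdorff_space Y"
    unfolding Hausdorff_space_def
  proof (intro allI impI, elim conjE)
    fix a b assume ab: "a \<in> topspace Y" "b \<in> topspace Y" "a \<noteq> b"
    show "\<exists>A B. openin Y A \<and> openin Y B \<and> a \<in> A \<and> b \<in> B \<and> disjnt A B"
    proof (cases a; cases b)
      fix x y assume xy: "a = Some x" "b = Some y"
      then have "x \<in> topspace X" "y \<in> topspace X" "x \<noteq> y"
        using ab topY by auto
      then obtain U V where "openin X U" "openin X V" "x \<in> U" "y \<in> V" "disjnt U V"
        using X(1) unfolding Hausdorff_space_def by blast
      moreover from this have "disjnt (Some ` U) (Some ` V)"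
        by (auto simp: disjnt_def)
      ultimately show ?thesis
        using xy openY_Some by blast
    next
      fix x assume "a = Some x" "b = None"
      then show ?thesis using sep[of x] ab topY by auto
    next
      fix y assume "a = None" "b = Some y"
      then show ?thesis using sep[of y] ab topY disjnt_sym by (metis imageE insertE option.distinct(1) option.inject)
    qed (use ab in auto)
  qed
  moreover have "partial_order_on (topspace Y) s"
  proof -
    have "s \<subseteq> topspace Y \<times> topspace Y"
      using r(1) F(1) by (auto simp: s_def topY)
    moreover have "refl_on (topspace Y) s"
      using r(2) by (auto simp: refl_on_def topY)
    moreover have "trans s"
    proof (rule transI)
      fix a b c assume "(a, b) \<in> s" "(b, c) \<in> s"
      then show "(a, c) \<in> s"
        using r(3) F(2) by (cases a; cases b; cases c) (auto dest: transD)
    qed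
    moreover have "antisym s"
    proof (rule antisymI)
      fix a b assume "(a, b) \<in> s" "(b, a) \<in> s"
      then show "a = b"
        using r(4) by (cases a; cases b) (auto dest: antisymD)
    qed
    ultimately show ?thesis
      by (simp add: partial_order_on_def preorder_on_def)
  qed
  moreover have "closedin (prod_topology Y Y) s"
  proof -
    have "\<exists>A B. openin Y A \<and> openin Y B \<and> a \<in> A \<and> b \<in> B \<and> A \<times> B \<subseteq> topspace Y \<times> topspace Y - s"
      if ab: "(a, b) \<in> topspace Y \<times> topspace Y - s" for a b
    proof -
      have "\<exists>A B. openin Y A \<and> openin Y B \<and> a \<in> A \<and> b \<in> B \<and> s \<inter> A \<times> B = {}"
      proof (cases a; cases b)
        fix x y assume xy: "a = Some x" "b = Some y"
        then have "(x, y) \<in> topspace X \<times> topspace X - r"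
          using ab topY by auto
        moreover have "openin (prod_topology X X) (topspace X \<times> topspace X - r)"
          using X(2) by (simp add: closedin_def)
        ultimately obtain U V where "openin X U" "openin X V" "x \<in> U" "y \<in> V"
          "U \<times> V \<subseteq> topspace X \<times> topspace X - r"
          unfolding openin_prod_topology_alt by meson
        moreover from this have "s \<inter> Some ` U \<times> Some ` V = {}"
          by auto
        ultimately show ?thesis
          using xy openY_Some by blast
      next
        fix x assume xb: "a = Some x" "b = None"
        then have "x \<in> topspace X" using ab topY by auto
        then obtain U N where UN: "openin X U" "openin X N" "x \<in> U" "\<forall>\<^sub>F w in G. w \<in> N"
          "r \<inter> U \<times> N = {}"
          using not_below by blast
        have "s \<inter> Some ` U \<times> insert None (Some ` N) = {}"
          using UN(5) by auto
        moreover have "openin Y (Some ` U)" "openin Y (insert None (Some ` N))"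
          using UN openY_Some openY_None by blast+
        ultimately show ?thesis
          using xb UN(3) by blast
      next
        fix y assume yb: "a = None" "b = Some y"
        then have "y \<in> topspace X - F" using ab topY by auto
        then obtain U N where UN: "openin X U" "openin X N" "y \<in> U" "\<forall>\<^sub>F w in G. w \<in> N"
          "disjnt U F" "r \<inter> N \<times> U = {}"
          using not_above by blast
        have "s \<inter> insert None (Some ` N) \<times> Some ` U = {}"
          using UN(5,6) by (auto simp: disjnt_iff)
        moreover have "openin Y (Some ` U)" "openin Y (insert None (Some ` N))"
          using UN openY_Some openY_None by blast+
        ultimately show ?thesis
          using yb UN(3) by blast
      qed (use ab in auto)
      then obtain A B where AB: "openin Y A" "openin Y B" "a \<in> A" "b \<in> B" "s \<inter> A \<times> B = {}"
        by blast
      then have "A \<times> B \<subseteq> topspace Y \<times> topspace Y - s"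
        using openin_subset[OF AB(1)] openin_subset[OF AB(2)] by blast
      then show ?thesis
        using AB by blast
    qed
    then have "openin (prod_topology Y Y) (topspace Y \<times> topspace Y - s)"
      unfolding openin_prod_topology_alt by blast
    moreover have "s \<subseteq> topspace Y \<times> topspace Y"
      using r(1) F(1) by (auto simp: s_def topY)
    ultimately show ?thesis
      by (simp add: closedin_def)
  qed
  ultimately have "pospace Y s"
    by (simp add: pospace_def)
  moreover have "pospace_embedding X r Y s Some"
    using embedding_map_adjoin_limit_topology[of X G]
    by (simp add: pospace_embedding_def Y_def)
  ultimately have "closedin Y (Some ` topspace X)"
    using H by (simp add: H_closed_pospace_def)
  then have "openin Y (topspace Y - Some ` topspace X)"
    by blast
  \<comment> \<open>In this form, openness of the singleton of the new point says that \<open>G\<close> contains the empty set.\<close>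
  moreover have "topspace Y - Some ` topspace X = insert None (Some ` {})"
    by (auto simp: topY)
  ultimately have "\<forall>\<^sub>F x in G. x \<in> {}"
    by (metis openY_None)
  then show False
    using nonbot by (simp add: trivial_limit_def)
qed

section \<open>Maximal chains with closed up-set\<close>

lemma pospace_closedin_principal_upset:
  assumes "pospace X r" "x \<in> topspace X"
  shows "closedin X (r `` {x})"
proof -
  have "continuous_map X (prod_topology X X) (Pair x)"
    using assms(2) by (simp add: continuous_map_pairedI)
  then have "closedin X {y \<in> topspace X. (x, y) \<in> r}"
    using assms(1) unfolding pospace_def by (auto intro: closedin_continuous_map_preimage)
  moreover have "{y \<in> topspace X. (x, y) \<in> r} = r `` {x}"
    using assms(1) by (auto simp: pospace_def partial_order_on_def preorder_on_def)
  ultimately show ?thesis by simp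
qed

lemma increasing_set_upset:
  assumes "refl_on A r" "r \<subseteq> A \<times> A" "trans r"
  shows "increasing_set r (r `` B)"
  using assms unfolding increasing_set_def refl_on_def trans_def by blast

lemma maximal_chain_memI:
  assumes L: "maximal_chain r L" and x: "(x, x) \<in> r" "\<And>l. l \<in> L \<Longrightarrow> (x, l) \<in> r \<or> (l, x) \<in> r"
  shows "x \<in> L"
proof (rule ccontr)
  assume "x \<notin> L"
  moreover have "insert x L \<in> Chains r"
    using L x by (auto simp: maximal_chain_def Chains_def)
  ultimately show False
    using L unfolding maximal_chain_def by blast
qed

text \<open>
  Disjointness of the two neighbourhoods upgrades to order separation, because one of them is
  increasing: a point above an element of \<open>V\<close> lies in \<open>V\<close>.
\<close>

lemma upper_regularly_orderedE:
  assumes "upper_regularly_ordered X r" "closedin X F" "increasing_set r F" "a \<in> topspace X - F"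
  obtains U V where "openin X U" "openin X V" "a \<in> U" "F \<subseteq> V" "disjnt U V"
    "r\<inverse> `` U = U" "r `` V = V" "r \<inter> V \<times> U = {}"
proof -
  obtain U V where UV: "openin X U" "openin X V" "a \<in> U" "F \<subseteq> V" "disjnt U V"
    "r\<inverse> `` U = U" "r `` V = V"
    using assms unfolding upper_regularly_ordered_def decreasing_set_def increasing_set_def by metis
  then have "r \<inter> V \<times> U = {}"
    by (auto simp: disjnt_iff)
  then show thesis
    using UV that by blast
qed

theorem corollary2p5:
  fixes X :: "'a topology" and r :: "'a rel" and L :: "'a set"
  assumes "topspace X \<noteq> {}"
    and "H_closed_pospace X r"
    and "upper_regularly_ordered X r"
    and "MCC_i_chain X r L"
  shows "\<exists>y\<in>L. minimal_in r L y"
proof (rule ccontr)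
  assume no_min: "\<not> (\<exists>y\<in>L. minimal_in r L y)"
  have X: "pospace X r"
    using assms(2) by (simp add: H_closed_pospace_def)
  then have r: "r \<subseteq> topspace X \<times> topspace X" "refl_on (topspace X) r" "trans r" "antisym r"
    by (auto simp: pospace_def partial_order_on_def preorder_on_def)
  have L: "maximal_chain r L" and closed_up: "closedin X (r `` L)"
    using assms(4) by (auto simp: MCC_i_chain_def)
  have chain: "(k, l) \<in> r \<or> (l, k) \<in> r" if "k \<in> L" "l \<in> L" for k l
    using L that unfolding maximal_chain_def Chains_def by blast
  have LX: "L \<subseteq> topspace X"
    using chain r(1) by blast
  have "L \<noteq> {}"
    using maximal_chain_memI[OF L] assms(1) r(2) by (fastforce simp: refl_on_def)
  have L_up: "L \<subseteq> r `` L"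
    using chain by blast
  have not_lower_bound: "\<exists>l\<in>L. (x, l) \<notin> r" if x: "x \<in> topspace X" for x
  proof (rule ccontr)
    assume "\<not> (\<exists>l\<in>L. (x, l) \<notin> r)"
    then have lower: "\<And>l. l \<in> L \<Longrightarrow> (x, l) \<in> r" by blast
    moreover have "(x, x) \<in> r"
      using x r(2) by (simp add: refl_on_def)
    ultimately have "x \<in> L"
      using maximal_chain_memI[OF L] by blast
    then have "minimal_in r L x"
      using lower by (auto simp: minimal_in_def)
    then show False
      using no_min \<open>x \<in> L\<close> by blast
  qed

  \<comment> \<open>The lower tails of a nonempty chain form a base of a proper filter, convergence along which is
    descent along \<open>L\<close>.\<close>
  define G where "G = (INF l\<in>L. principal {m \<in> L. (m, l) \<in> r})"
  have ev_G: "eventually P G \<longleftrightarrow> (\<exists>l\<in>L. \<forall>m\<in>L. (m, l) \<in> r \<longrightarrow> P m)" for P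
  proof -
    have "\<exists>j\<in>L. principal {m \<in> L. (m, j) \<in> r} \<le>
        inf (principal {m \<in> L. (m, k) \<in> r}) (principal {m \<in> L. (m, l) \<in> r})"
      if "k \<in> L" "l \<in> L" for k l
      using chain[OF that] that r(3) by (auto dest: transD)
    then show ?thesis
      unfolding G_def using \<open>L \<noteq> {}\<close>
      by (subst eventually_INF_base) (auto simp: eventually_principal)
  qed
  have "G = bot"
  proof (rule H_closed_pospace_no_new_lower_limit[OF assms(2), where F = "r `` L"])
    show "\<forall>\<^sub>F x in G. x \<in> topspace X"
      unfolding ev_G using LX \<open>L \<noteq> {}\<close> by blast
    show "r `` L \<subseteq> topspace X"
      using r(1) by blast
    show "r `` (r `` L) \<subseteq> r `` L"
      using r(3) by (auto dest: transD)
  next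
    fix x assume x: "x \<in> topspace X"
    then obtain l where l: "l \<in> L" "(x, l) \<notin> r"
      using not_lower_bound by blast
    obtain U V where UV: "openin X U" "openin X V" "l \<in> U" "r `` {x} \<subseteq> V"
      "r\<inverse> `` U = U" "r \<inter> V \<times> U = {}"
      by (rule upper_regularly_orderedE[OF assms(3), of "r `` {x}" l])
        (use l LX pospace_closedin_principal_upset[OF X x] increasing_set_upset[OF r(2,1,3)] in auto)
    moreover have "x \<in> V"
      using UV(4) x r(2) by (auto simp: refl_on_def)
    moreover have "\<forall>\<^sub>F w in G. w \<in> U"
      unfolding ev_G using l(1) UV(3,5) by blast
    ultimately show "\<exists>U N. openin X U \<and> openin X N \<and> x \<in> U \<and> (\<forall>\<^sub>F w in G. w \<in> N) \<and> r \<inter> U \<times> N = {}"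
      by blast
  next
    fix x assume x: "x \<in> topspace X - r `` L"
    obtain U V where UV: "openin X U" "openin X V" "x \<in> U" "r `` L \<subseteq> V" "disjnt U V" "r \<inter> V \<times> U = {}"
      by (rule upper_regularly_orderedE[OF assms(3) closed_up increasing_set_upset[OF r(2,1,3)] x])
    moreover have "\<forall>\<^sub>F w in G. w \<in> V"
      unfolding ev_G using UV(4) L_up \<open>L \<noteq> {}\<close> by blast
    moreover have "disjnt U (r `` L)"
      using UV(4,5) by (auto simp: disjnt_iff)
    ultimately show "\<exists>U N. openin X U \<and> openin X N \<and> x \<in> U \<and> (\<forall>\<^sub>F w in G. w \<in> N) \<and>
        disjnt U (r `` L) \<and> r \<inter> N \<times> U = {}"
      by blast
  qed
  moreover have "G \<noteq> bot"
    unfolding trivial_limit_def ev_G using chain by blast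
  ultimately show False
    by blast
qed

end
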